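(* Let $\phi(z)=Az+p(z)$, $A\ge1$, be a self-map of $\mathbb{H}$ of non-zero-step type. Let $z_0,\tilde z_0\in\mathbb{H}$ and let $(g,\alpha)$, $\alpha(z)=Az+b$, and $(\tilde g,\tilde\alpha)$, $\tilde\alpha(z)=Az+\tilde b$, be the classical semiconjugations of $\phi$ based at $z_0$ and $\tilde z_0$ respectively. Then, when $A>1$, $$\frac{\tilde g+\frac{\tilde b}{A-1}}{i+\frac{\tilde b}{A-1}}=\frac{g+\frac{b}{A-1}}{g(\tilde z_0)+\frac{b}{A-1}}\quad\text{on }\mathbb{H},$$ while, when $A=1$, $$\frac{\tilde g-i}{|\tilde b|}=\frac{g-g(\tilde z_0)}{|b|}\quad\text{on }\mathbb{H}.$$
   Context: $\mathbb{H}=\{z\in\mathbb{C}:\operatorname{Im}z>0\}$; $\rho_{\mathbb{H}}$ is the hyperbolic distance; $\phi_n$ is the $n$-th iterate of $\phi$; n.t.-lim as $z\to\infty$ means the limit as $z\to\infty$ inside each sector $\{|\operatorname{Arg}z-\pi/2|<\theta\}$, $0<\theta<\pi/2$. Here a self-map of $\mathbb{H}$ is an analytic map $\phi:\mathbb{H}\to\mathbb{H}$ that is not an automorphism. We consider $\phi(z)=Az+p(z)$ with $A\ge 1$, $\operatorname{Im}p>0$ on $\mathbb{H}$ and n.t.-$\lim_{z\to\infty}p(z)/z=0$. It is hyperbolic if $A>1$ and parabolic if $A=1$. For $z\in\mathbb{H}$ the sequence $\rho_{\mathbb{H}}(\phi_n(z),\phi_{n+1}(z))$ decreases to a limit $s_\infty(z)\ge0$;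 for parabolic $\phi$, $s_\infty$ vanishes either everywhere (zero-step) or nowhere (non-zero-step). $\phi$ is of non-zero-step type if it is hyperbolic or parabolic non-zero-step. Classical semiconjugation based at $z_0$ (for $\phi$ of non-zero-step type): let $z_n=\phi_n(z_0)=x_n+iy_n$ and $\gamma_n(z)=(z-x_n)/y_n$. By a theorem of Pommerenke, $g=\lim_n\gamma_n\circ\phi_n$ exists locally uniformly in $\mathbb{H}$, is an analytic map $\mathbb{H}\to\mathbb{H}$ with $g(z_0)=i$, the maps $\gamma_n\circ\gamma_{n+1}^{-1}$ converge to $\alpha(z)=Az+b$ with $b=\lim_n(x_{n+1}-x_n)/y_n\in\mathbb{R}$, and $g\circ\phi=\alpha\circ g$; if $A=1$ then $b\neq0$. *)

theory Defs
  imports "HOL-Complex_Analysis.Complex_Analysis"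
begin

definition upper_halfplane :: "complex set"  (\<open>\<H>\<close>) where
  "\<H> = {z. Im z > 0}"

(* Curvature -1 normalisation; other normalisations differ by a constant factor. *)
definition hyp_dist :: "complex \<Rightarrow> complex \<Rightarrow> real" where
  "hyp_dist z w = arcosh (1 + (cmod (z - w))\<^sup>2 / (2 * Im z * Im w))"

definition automorphism_H :: "(complex \<Rightarrow> complex) \<Rightarrow> bool" where
  "automorphism_H \<phi> \<longleftrightarrow>
     \<phi> holomorphic_on \<H> \<and> \<phi> \<in> \<H> \<rightarrow> \<H> \<and>
     (\<exists>\<psi>. \<psi> holomorphic_on \<H> \<and> \<psi> \<in> \<H> \<rightarrow> \<H> \<and>
          (\<forall>z\<in>\<H>. \<psi> (\<phi> z) = z \<and> \<phi> (\<psi> z) = z))"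

definition self_map_H :: "(complex \<Rightarrow> complex) \<Rightarrow> bool" where
  "self_map_H \<phi> \<longleftrightarrow>
     \<phi> holomorphic_on \<H> \<and> \<phi> \<in> \<H> \<rightarrow> \<H> \<and> \<not> automorphism_H \<phi>"

(* For 0 < \<theta> < pi/2 this sector lies in \<H>; it omits 0 because Arg 0 = 0. *)
definition sector :: "real \<Rightarrow> complex set" where
  "sector \<theta> = {z. \<bar>Arg z - pi / 2\<bar> < \<theta>}"

definition nt_lim_infinity :: "(complex \<Rightarrow> complex) \<Rightarrow> complex \<Rightarrow> bool" where
  "nt_lim_infinity f l \<longleftrightarrow>
     (\<forall>\<theta>. 0 < \<theta> \<and> \<theta> < pi / 2 \<longrightarrow>
        (f \<longlongrightarrow> l) (inf at_infinity (principal (sector \<theta>))))"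

(* By the Schwarz-Pick lemma the sequence is nonincreasing for a self-map and z \<in> \<H>,
   so the limit exists. *)
definition s_infinity :: "(complex \<Rightarrow> complex) \<Rightarrow> complex \<Rightarrow> real" where
  "s_infinity \<phi> z = lim (\<lambda>n. hyp_dist ((\<phi> ^^ n) z) ((\<phi> ^^ Suc n) z))"

(* A is the coefficient in \<phi>(z) = A z + p(z): hyperbolic means A > 1, parabolic A = 1. *)
definition non_zero_step_type :: "(complex \<Rightarrow> complex) \<Rightarrow> real \<Rightarrow> bool" where
  "non_zero_step_type \<phi> A \<longleftrightarrow>
     A > 1 \<or> (A = 1 \<and> (\<forall>z\<in>\<H>. s_infinity \<phi> z \<noteq> 0))"

(* The affine map sending w = x + iy to i. *)
definition normalizing_map :: "complex \<Rightarrow> complex \<Rightarrow> complex" where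
  "normalizing_map w z = (z - of_real (Re w)) / of_real (Im w)"

definition semiconj_gamma ::
    "(complex \<Rightarrow> complex) \<Rightarrow> complex \<Rightarrow> nat \<Rightarrow> complex \<Rightarrow> complex" where
  "semiconj_gamma \<phi> z0 n = normalizing_map ((\<phi> ^^ n) z0)"

(* Locally uniform convergence on \<H> is expressed as uniform convergence on compact subsets.
   Only the two defining limits are required. The remaining properties given by Pommerenke's
   theorem (g is analytic from \<H> to \<H>, g z0 = \<i>, g \<circ> \<phi> = \<alpha> \<circ> g) are not part of the definition.
   Since gamma_n (gamma_{n+1}^{-1} z) = (y_{n+1}/y_n) z + (x_{n+1} - x_n)/y_n,
   for \<alpha> z = A z + b with A, b real the second limit says exactly that
   y_{n+1}/y_n tends to A and (x_{n+1} - x_n)/y_n tends to b. *)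
definition classical_semiconjugation ::
    "(complex \<Rightarrow> complex) \<Rightarrow> complex \<Rightarrow> (complex \<Rightarrow> complex) \<Rightarrow> (complex \<Rightarrow> complex) \<Rightarrow> bool" where
  "classical_semiconjugation \<phi> z0 g \<alpha> \<longleftrightarrow>
     (\<forall>K. compact K \<and> K \<subseteq> \<H> \<longrightarrow>
        uniform_limit K (\<lambda>n. semiconj_gamma \<phi> z0 n \<circ> (\<phi> ^^ n)) g sequentially) \<and>
     (\<forall>z\<in>\<H>. (\<lambda>n. (semiconj_gamma \<phi> z0 n \<circ> inv (semiconj_gamma \<phi> z0 (Suc n))) z)
               \<longlonglongrightarrow> \<alpha> z)"

end

(* Write z_n = x_n + i y_n and z'_n = u_n + i v_n for the orbits of z0 and z0', and
   g(z0') = s + i c. Letting n tend to infinity in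
     (phi_n - u_n)/v_n = ((phi_n - x_n)/y_n - (u_n - x_n)/y_n) / (v_n/y_n)
   gives g' = (g - s)/c as soon as c > 0. This positivity is the open mapping theorem: g maps
   into the closed upper half-plane and takes the interior value i at z0. Comparing the
   functional equations g o phi = A g + b and g' o phi = A g' + b' yields c b' = b + (A - 1) s,
   and both formulas follow by algebra. In particular A = 1 gives c |b'| = |b|, so if b = 0 then
   b' = 0 and both sides vanish because x/0 = 0. *)
theory Submission
  imports Defs
begin

lemma open_upper_halfplane: "open \<H>"
  unfolding upper_halfplane_def by (rule open_halfspace_Im_gt)

lemma connected_upper_halfplane: "connected \<H>"
  unfolding upper_halfplane_def by (intro convex_connected convex_halfspace_Im_gt)

lemma funpow_mem:
  assumes "\<phi> \<in> S \<rightarrow> S" "z \<in> S"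
  shows "(\<phi> ^^ n) z \<in> S"
  using assms by (induction n) auto

lemma holomorphic_on_funpow:
  assumes "\<phi> holomorphic_on S" "\<phi> \<in> S \<rightarrow> S"
  shows "(\<phi> ^^ n) holomorphic_on S"
proof (induction n)
  case 0
  then show ?case by (simp add: holomorphic_on_ident id_def)
next
  case (Suc n)
  have "(\<phi> ^^ n) ` S \<subseteq> S"
    using funpow_mem[OF assms(2)] by blast
  with Suc assms(1) show ?case
    unfolding funpow.simps by (rule holomorphic_on_compose_gen)
qed

text \<open>Since \<open>Im w\<close> is nonzero, the affine map is injective on all of the complex
  plane, so \<open>inv\<close> is its genuine inverse at every \<open>z\<close>, inside
  \<open>\<H>\<close> or not.\<close>

lemma inv_normalizing_map:
  assumes "w \<in> \<H>"
  shows "inv (normalizing_map w) z = of_real (Im w) * z + of_real (Re w)"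
proof (rule inv_f_eq)
  have "complex_of_real (Im w) \<noteq> 0"
    using assms by (simp add: upper_halfplane_def)
  then show "inj (normalizing_map w)"
    and "normalizing_map w (of_real (Im w) * z + of_real (Re w)) = z"
    by (auto simp: inj_def normalizing_map_def)
qed

lemma Im_normalizing_map_pos:
  assumes "w \<in> \<H>" "z \<in> \<H>"
  shows "Im (normalizing_map w z) > 0"
  using assms by (simp add: normalizing_map_def upper_halfplane_def)

text \<open>A nonconstant \<open>f\<close> has an open image inside the closed half-plane, hence
  inside its interior. A constant \<open>f\<close> takes the value \<open>f a\<close>
  everywhere.\<close>

lemma holomorphic_open_mapping_Im_pos:
  assumes hol: "f holomorphic_on S" and S: "open S" "connected S"
    and nonneg: "\<And>z. z \<in> S \<Longrightarrow> Im (f z) \<ge> 0"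
    and a: "a \<in> S" "Im (f a) > 0" and z: "z \<in> S"
  shows "Im (f z) > 0"
proof (cases "f constant_on S")
  case True
  then show ?thesis
    using a z unfolding constant_on_def by metis
next
  case False
  have "open (f ` S)"
    using open_mapping_thm[OF hol S S(1) order_refl False] .
  then have "f ` S \<subseteq> interior {w. Im w \<ge> 0}"
    using nonneg by (intro interior_maximal) auto
  \<comment> \<open>The real inner product with \<open>\<i>\<close> is the imaginary part, so this
    is the half-space with normal \<open>\<i>\<close>.\<close>
  moreover have "interior {w::complex. Im w \<ge> 0} = {w. Im w > 0}"
    using interior_halfspace_ge[of \<i> 0] by (simp add: inner_complex_def)
  ultimately show ?thesis
    using z by auto
qed

lemma classical_semiconjugation_uniform_limit:
  assumes "classical_semiconjugation \<phi> z0 g \<alpha>" "compact K" "K \<subseteq> \<H>"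
  shows "uniform_limit K (\<lambda>n. semiconj_gamma \<phi> z0 n \<circ> (\<phi> ^^ n)) g sequentially"
  using assms by (simp add: classical_semiconjugation_def)

text \<open>Singletons are compact, so uniform convergence on compact sets contains pointwise
  convergence.\<close>

lemma classical_semiconjugation_tendsto:
  assumes "classical_semiconjugation \<phi> z0 g \<alpha>" "z \<in> \<H>"
  shows "(\<lambda>n. normalizing_map ((\<phi> ^^ n) z0) ((\<phi> ^^ n) z)) \<longlonglongrightarrow> g z"
proof -
  have "uniform_limit {z} (\<lambda>n. semiconj_gamma \<phi> z0 n \<circ> (\<phi> ^^ n)) g sequentially"
    using assms by (intro classical_semiconjugation_uniform_limit[OF assms(1)]) auto
  from tendsto_uniform_limitI[OF this, of z] show ?thesis
    by (simp add: semiconj_gamma_def)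
qed

lemma classical_semiconjugation_base:
  assumes "\<phi> \<in> \<H> \<rightarrow> \<H>" "classical_semiconjugation \<phi> z0 g \<alpha>" "z0 \<in> \<H>"
  shows "g z0 = \<i>"
proof -
  have "normalizing_map w w = \<i>" if "w \<in> \<H>" for w
    using that by (auto simp: normalizing_map_def upper_halfplane_def complex_eq_iff)
  then have "(\<lambda>n. normalizing_map ((\<phi> ^^ n) z0) ((\<phi> ^^ n) z0)) = (\<lambda>_. \<i>)"
    using funpow_mem[OF assms(1,3)] by auto
  with classical_semiconjugation_tendsto[OF assms(2,3)] show ?thesis
    by (simp add: LIMSEQ_const_iff)
qed

text \<open>Weierstrass: each approximant is an affine map after an iterate of
  \<open>\<phi>\<close>, and closed discs in \<open>\<H>\<close> are among the compact sets of
  uniform convergence.\<close>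

lemma classical_semiconjugation_holomorphic:
  assumes "\<phi> holomorphic_on \<H>" "\<phi> \<in> \<H> \<rightarrow> \<H>" "classical_semiconjugation \<phi> z0 g \<alpha>"
    "z0 \<in> \<H>"
  shows "g holomorphic_on \<H>"
proof (rule holomorphic_uniform_sequence[OF open_upper_halfplane])
  show "(semiconj_gamma \<phi> z0 n \<circ> (\<phi> ^^ n)) holomorphic_on \<H>" for n
  proof (rule holomorphic_on_compose[OF holomorphic_on_funpow[OF assms(1,2)]])
    have "complex_of_real (Im ((\<phi> ^^ n) z0)) \<noteq> 0"
      using funpow_mem[OF assms(2,4), of n] by (simp add: upper_halfplane_def)
    then show "semiconj_gamma \<phi> z0 n holomorphic_on (\<phi> ^^ n) ` \<H>"
      unfolding semiconj_gamma_def normalizing_map_def[abs_def]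
      by (intro holomorphic_intros)
  qed
  fix x assume "x \<in> \<H>"
  then obtain d where "d > 0" "cball x d \<subseteq> \<H>"
    using open_upper_halfplane open_contains_cball by blast
  then show "\<exists>d>0. cball x d \<subseteq> \<H> \<and>
      uniform_limit (cball x d) (\<lambda>n. semiconj_gamma \<phi> z0 n \<circ> (\<phi> ^^ n)) g sequentially"
    using classical_semiconjugation_uniform_limit[OF assms(3) compact_cball] by blast
qed

text \<open>The approximants have positive imaginary part, but the limit retains only
  \<open>\<ge>\<close>. Strictness is recovered from the value \<open>\<i>\<close> at
  \<open>z0\<close>.\<close>

lemma classical_semiconjugation_Im_pos:
  assumes "\<phi> holomorphic_on \<H>" "\<phi> \<in> \<H> \<rightarrow> \<H>" "classical_semiconjugation \<phi> z0 g \<alpha>"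
    "z0 \<in> \<H>" "z \<in> \<H>"
  shows "Im (g z) > 0"
proof (rule holomorphic_open_mapping_Im_pos[OF classical_semiconjugation_holomorphic[OF assms(1-4)]
      open_upper_halfplane connected_upper_halfplane _ assms(4) _ assms(5)])
  show "Im (g z0) > 0"
    using classical_semiconjugation_base[OF assms(2-4)] by simp
  fix w assume w: "w \<in> \<H>"
  show "Im (g w) \<ge> 0"
    by (rule LIMSEQ_le_const[OF tendsto_Im[OF classical_semiconjugation_tendsto[OF assms(3) w]]])
      (auto intro!: less_imp_le Im_normalizing_map_pos funpow_mem assms w)
qed

text \<open>Let n tend to infinity in gamma_n o phi_n o phi = (gamma_n o gamma_{n+1}^{-1}) o
  (gamma_{n+1} o phi_{n+1}).\<close>

lemma classical_semiconjugation_functional_equation: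
  fixes A b :: real
  assumes \<phi>: "\<phi> \<in> \<H> \<rightarrow> \<H>"
    and g: "classical_semiconjugation \<phi> z0 g (\<lambda>z. of_real A * z + of_real b)"
    and z0: "z0 \<in> \<H>" and z: "z \<in> \<H>"
  shows "g (\<phi> z) = of_real A * g z + of_real b"
proof -
  define w where "w n = (\<phi> ^^ n) z0" for n
  define \<zeta> where "\<zeta> n = (\<phi> ^^ n) z" for n
  have \<zeta>_Suc: "\<zeta> (Suc n) = (\<phi> ^^ n) (\<phi> z)" for n
    by (simp add: \<zeta>_def funpow_Suc_right del: funpow.simps)
  \<comment> \<open>\<open>r n\<close> and \<open>t n\<close> are the slope and the translation part
    of gamma_n o gamma_{n+1}^{-1}. The argument of this map will vary with \<open>n\<close>, so
    pointwise convergence is first turned into convergence of the two coefficients.\<close>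
  define r where "r n = complex_of_real (Im (w (Suc n)) / Im (w n))" for n
  define t where "t n = complex_of_real ((Re (w (Suc n)) - Re (w n)) / Im (w n))" for n
  have w: "w n \<in> \<H>" for n
    using funpow_mem[OF \<phi> z0] by (simp add: w_def)
  then have nz: "complex_of_real (Im (w n)) \<noteq> 0" for n
    by (simp add: upper_halfplane_def less_imp_neq[THEN not_sym])
  have "(\<lambda>n. normalizing_map (w n) (inv (normalizing_map (w (Suc n))) \<xi>)) \<longlonglongrightarrow> of_real A * \<xi> + of_real b"
    if "\<xi> \<in> \<H>" for \<xi>
    using g that by (simp add: classical_semiconjugation_def semiconj_gamma_def w_def o_def)
  moreover have "normalizing_map (w n) (inv (normalizing_map (w (Suc n))) \<xi>) = r n * \<xi> + t n" for n \<xi>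
    using nz[of n]
    by (simp add: inv_normalizing_map[OF w] normalizing_map_def r_def t_def field_simps)
  ultimately have lim: "(\<lambda>n. r n * \<xi> + t n) \<longlonglongrightarrow> of_real A * \<xi> + of_real b" if "\<xi> \<in> \<H>" for \<xi>
    using that by simp
  \<comment> \<open>The limit is available only at points of \<open>\<H>\<close>. The two points
    \<open>2 * \<i>\<close> and \<open>\<i>\<close> suffice: their difference eliminates
    \<open>t n\<close> and isolates the slope.\<close>
  have "(\<lambda>n. ((r n * (2 * \<i>) + t n) - (r n * \<i> + t n)) / \<i>) \<longlonglongrightarrow>
      ((of_real A * (2 * \<i>) + of_real b) - (of_real A * \<i> + of_real b)) / \<i>"
    by (intro tendsto_intros lim) (auto simp: upper_halfplane_def)
  then have r: "r \<longlonglongrightarrow> of_real A"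
    by (simp add: field_simps)
  have "(\<lambda>n. (r n * \<i> + t n) - r n * \<i>) \<longlonglongrightarrow> (of_real A * \<i> + of_real b) - of_real A * \<i>"
    by (intro tendsto_intros lim r) (auto simp: upper_halfplane_def)
  then have t: "t \<longlonglongrightarrow> of_real b"
    by simp
  have "(\<lambda>n. normalizing_map (w n) (\<zeta> n)) \<longlonglongrightarrow> g z"
    using classical_semiconjugation_tendsto[OF g z] by (simp add: w_def \<zeta>_def)
  then have "(\<lambda>n. r n * normalizing_map (w (Suc n)) (\<zeta> (Suc n)) + t n) \<longlonglongrightarrow>
      of_real A * g z + of_real b"
    by (intro tendsto_intros r t) (rule LIMSEQ_Suc)
  moreover have "r n * normalizing_map (w (Suc n)) (\<zeta> (Suc n)) + t n
      = normalizing_map (w n) ((\<phi> ^^ n) (\<phi> z))" for n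
    using nz[of n] nz[of "Suc n"]
    by (simp add: \<zeta>_Suc normalizing_map_def r_def t_def field_simps)
  ultimately have "(\<lambda>n. normalizing_map (w n) ((\<phi> ^^ n) (\<phi> z))) \<longlonglongrightarrow> of_real A * g z + of_real b"
    by simp
  moreover have "(\<lambda>n. normalizing_map (w n) ((\<phi> ^^ n) (\<phi> z))) \<longlonglongrightarrow> g (\<phi> z)"
    using classical_semiconjugation_tendsto[OF g, of "\<phi> z"] \<phi> z by (auto simp: w_def)
  ultimately show ?thesis
    by (metis LIMSEQ_unique)
qed

text \<open>Normalizing at \<open>w' n\<close> is the same as normalizing at \<open>w n\<close> and
  then at the image of \<open>w' n\<close>. That image is \<open>h n z0'\<close>, which tends to
  \<open>g z0'\<close>.\<close>

lemma classical_semiconjugation_change_base: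
  assumes \<phi>: "\<phi> holomorphic_on \<H>" "\<phi> \<in> \<H> \<rightarrow> \<H>"
    and g: "classical_semiconjugation \<phi> z0 g \<alpha>" and g': "classical_semiconjugation \<phi> z0' g' \<alpha>'"
    and z0: "z0 \<in> \<H>" and z0': "z0' \<in> \<H>" and z: "z \<in> \<H>"
  shows "g' z = (g z - of_real (Re (g z0'))) / of_real (Im (g z0'))"
proof -
  define w where "w n = (\<phi> ^^ n) z0" for n
  define w' where "w' n = (\<phi> ^^ n) z0'" for n
  define h where "h n \<zeta> = normalizing_map (w n) ((\<phi> ^^ n) \<zeta>)" for n \<zeta>
  have "w n \<in> \<H>" "w' n \<in> \<H>" for n
    using funpow_mem[OF \<phi>(2)] z0 z0' by (auto simp: w_def w'_def)
  then have nz: "Im (w n) \<noteq> 0" "Im (w' n) \<noteq> 0" for n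
    by (simp_all add: upper_halfplane_def less_imp_neq[THEN not_sym])
  have h: "(\<lambda>n. h n \<zeta>) \<longlonglongrightarrow> g \<zeta>" if "\<zeta> \<in> \<H>" for \<zeta>
    using classical_semiconjugation_tendsto[OF g that] by (simp add: h_def w_def)
  have "Im (g z0') \<noteq> 0"
    using classical_semiconjugation_Im_pos[OF \<phi> g z0 z0'] by simp
  then have "(\<lambda>n. (h n z - of_real (Re (h n z0'))) / of_real (Im (h n z0'))) \<longlonglongrightarrow>
      (g z - of_real (Re (g z0'))) / of_real (Im (g z0'))"
    by (intro tendsto_intros h z z0') simp
  moreover have "(h n z - of_real (Re (h n z0'))) / of_real (Im (h n z0'))
      = normalizing_map (w' n) ((\<phi> ^^ n) z)" for n
    using nz[of n] by (simp add: h_def normalizing_map_def w'_def[symmetric] field_simps)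
  ultimately have "(\<lambda>n. normalizing_map (w' n) ((\<phi> ^^ n) z)) \<longlonglongrightarrow>
      (g z - of_real (Re (g z0'))) / of_real (Im (g z0'))"
    by simp
  moreover have "(\<lambda>n. normalizing_map (w' n) ((\<phi> ^^ n) z)) \<longlonglongrightarrow> g' z"
    using classical_semiconjugation_tendsto[OF g' z] by (simp add: w'_def)
  ultimately show ?thesis
    by (metis LIMSEQ_unique)
qed

theorem corollary3p3:
  fixes \<phi> p g g' :: "complex \<Rightarrow> complex"
    and A b b' :: real
    and z0 z0' :: complex
  assumes "self_map_H \<phi>"
    and "A \<ge> 1"
    and "\<And>z. z \<in> \<H> \<Longrightarrow> \<phi> z = of_real A * z + p z"
    and "\<And>z. z \<in> \<H> \<Longrightarrow> Im (p z) > 0"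
    and "nt_lim_infinity (\<lambda>z. p z / z) 0"
    and "non_zero_step_type \<phi> A"
    and "z0 \<in> \<H>" and "z0' \<in> \<H>"
    and "classical_semiconjugation \<phi> z0 g (\<lambda>z. of_real A * z + of_real b)"
    and "classical_semiconjugation \<phi> z0' g' (\<lambda>z. of_real A * z + of_real b')"
  shows "(A > 1 \<longrightarrow>
            (\<forall>z\<in>\<H>. (g' z + of_real (b' / (A - 1))) / (\<i> + of_real (b' / (A - 1)))
                  = (g z + of_real (b / (A - 1))) / (g z0' + of_real (b / (A - 1))))) \<and>
         (A = 1 \<longrightarrow>
            (\<forall>z\<in>\<H>. (g' z - \<i>) / of_real \<bar>b'\<bar> = (g z - g z0') / of_real \<bar>b\<bar>))"
proof -
  have \<phi>: "\<phi> holomorphic_on \<H>" "\<phi> \<in> \<H> \<rightarrow> \<H>"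
    using assms(1) by (auto simp: self_map_H_def)
  define s where "s = Re (g z0')"
  define c where "c = Im (g z0')"
  have c: "c > 0"
    using classical_semiconjugation_Im_pos[OF \<phi> assms(9,7,8)] by (simp add: c_def)
  have g': "g' z = (g z - of_real s) / of_real c" if "z \<in> \<H>" for z
    using classical_semiconjugation_change_base[OF \<phi> assms(9,10,7,8) that] by (simp add: s_def c_def)
  have g'_base: "\<i> = (g z0' - of_real s) / of_real c"
    using g'[OF assms(8)] classical_semiconjugation_base[OF \<phi>(2) assms(10,8)] by simp
  have "\<phi> z0 \<in> \<H>"
    using \<phi> assms(7) by auto
  \<comment> \<open>Computing \<open>g' (\<phi> z0)\<close> through either functional equation gives
    \<open>(A * g z0 + b - s) / c = A * (g z0 - s) / c + b'\<close>. The terms in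
    \<open>g z0\<close> cancel, leaving a relation between real numbers.\<close>
  from g'[OF this] g'[OF assms(7)]
    classical_semiconjugation_functional_equation[OF \<phi>(2) assms(9,7,7)]
    classical_semiconjugation_functional_equation[OF \<phi>(2) assms(10,8,7)]
  have "complex_of_real (c * b') = of_real (b + (A - 1) * s)"
    using c by (simp add: field_simps)
  then have b': "b' = (b + (A - 1) * s) / c"
    using c by (simp only: of_real_eq_iff) (simp add: field_simps)
  show ?thesis
  proof (intro conjI impI ballI)
    fix z assume A: "A > 1" and z: "z \<in> \<H>"
    \<comment> \<open>The number \<open>- b / (A - 1)\<close> is the fixed point of
      \<open>A * z + b\<close>. The change of base \<open>(z - s) / c\<close> carries it to the
      fixed point of \<open>A * z + b'\<close>, so measured from the fixed points \<open>g'\<close>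
      and \<open>g\<close> differ only by the factor \<open>1 / c\<close>.\<close>
    have beta: "complex_of_real (b' / (A - 1)) = (of_real (b / (A - 1)) + of_real s) / of_real c"
      unfolding of_real_add[symmetric] of_real_divide[symmetric] of_real_eq_iff
      using A c by (simp add: b' field_simps)
    have "g' z + of_real (b' / (A - 1)) = (g z + of_real (b / (A - 1))) / of_real c"
      unfolding beta g'[OF z] by (simp add: add_divide_distrib[symmetric])
    moreover have "\<i> + of_real (b' / (A - 1)) = (g z0' + of_real (b / (A - 1))) / of_real c"
      unfolding beta by (subst g'_base) (simp add: add_divide_distrib[symmetric])
    ultimately show "(g' z + of_real (b' / (A - 1))) / (\<i> + of_real (b' / (A - 1)))
        = (g z + of_real (b / (A - 1))) / (g z0' + of_real (b / (A - 1)))"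
      using c by simp
  next
    fix z assume A: "A = 1" and z: "z \<in> \<H>"
    have "g' z - \<i> = (g z - g z0') / of_real c"
      unfolding g'[OF z] by (subst g'_base) (simp add: diff_divide_distrib[symmetric])
    \<comment> \<open>For \<open>A = 1\<close> the term with \<open>s\<close> drops out, and
      \<open>c > 0\<close> passes through the absolute value.\<close>
    moreover have "\<bar>b'\<bar> = \<bar>b\<bar> / c"
      using A c by (simp add: b')
    ultimately show "(g' z - \<i>) / of_real \<bar>b'\<bar> = (g z - g z0') / of_real \<bar>b\<bar>"
      using c by simp
  qed
qed

end
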